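(* Let $f_{W^1,\ldots,W^L}:\mathbb{R}^N\to\mathbb{R}^{d_L}$ be a neural network with weight matrices $W=(W^1,\ldots,W^L)$, $W^l\in\mathbb{R}^{d_l\times d_{l-1}}$, $d_0=N$, and with continuous piecewise affine activation functions $\sigma^1,\ldots,\sigma^L$ given by slopes $\alpha_i^l$, intercepts $\gamma_i^l$ and interval bounds $\underline{\beta}^{i,l},\overline{\beta}^{i,l}$ ($i\in[k_l]$, $l\in[L]$). Let $\|\cdot\|$ be an arbitrary norm on $\mathbb{R}^{d_L}$, let $\bar c\in\mathbb{R}^{d_L}$ and $R>0$, and let $$U_f(W,\bar c,R)=\{c\in\mathbb{R}^N : \|f_{W^1,\ldots,W^L}(c)-\bar c\|\le R\}.$$ Then $$U_f(W,\bar c,R)=\bigcup_{u\in\mathcal A}P(W,u,\bar c,R),$$ where, for each $u\in\mathcal A$, $$P(W,u,\bar c,R)=\Big\{c\in\mathbb{R}^N : \ \tilde W^l c+\tilde\gamma^l<\sum_{i\in[k_l]}u^{i,l}\overline{\beta}^{i,l}\ \ \forall l\in[L],\quad \tilde W^l c+\tilde\gamma^l\ge\sum_{i\in[k_l]}u^{i,l}\underline{\beta}^{i,l}\ \ \forall l\in[L],\quad \|\tilde W^{L+1}c+\tilde\gamma^{L+1}-\bar c\|\le R\Big\},$$ with $\tilde W^l$ and $\tilde\gamma^l$ (which depend on $W$ and $u$) as defined in the context.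
   Context: Notation: $[k]=\{1,\ldots,k\}$; $\mathbf 1$ is the all-ones vector; $E_n$ is the $n\times n$ identity matrix; $\mathrm{diag}(v)$ is the diagonal matrix with diagonal $v$. Products of matrices are ordered as $\prod_{i=a}^{b}M^i:=M^bM^{b-1}\cdots M^a$ (an empty product is the identity). Vector inequalities are componentwise. Neural network: $f_{W^1,\ldots,W^L}(c)=\sigma^L(W^L\sigma^{L-1}(W^{L-1}\cdots\sigma^1(W^1c)\cdots))$, where each $\sigma^l:\mathbb{R}\to\mathbb{R}$ is applied componentwise. Activation functions: for each $l\in[L]$, $\sigma^l$ is a continuous function with $\sigma^l(w)=\alpha_i^l w+\gamma_i^l$ whenever $\underline{\beta}^{i,l}\le w\le\overline{\beta}^{i,l}$, $i\in[k_l]$, where $k_l\in\mathbb{N}$, $\alpha_i^l,\gamma_i^l\in\mathbb{R}$, $\underline{\beta}^{i,l}<\overline{\beta}^{i,l}$, $\overline{\beta}^{i,l}=\underline{\beta}^{i+1,l}$ for $i<k_l$, $\underline{\beta}^{1,l}=-\infty$ and $\overline{\beta}^{k_l,l}=\infty$. Activation patterns: $\mathcal A=\{u=(u^{i,l})_{l\in[L],i\in[k_l]} : u^{i,l}\in\{0,1\}^{d_l},\ \sum_{i\in[k_l]}u^{i,l}=\mathbf 1\ \forall l\in[L]\}$. In the sums $\sum_i u^{i,l}\overline{\beta}^{i,l}$ and $\sum_i u^{i,l}\underline{\beta}^{i,l}$ (vectors with $d_l$ entries in $\mathbb{R}\cup\{\pm\infty\}$) the convention $0\cdot(\pm\infty)=0$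 is used. For fixed $u\in\mathcal A$, set $W^{L+1}=E_{d_L}$, $\tilde W^1=W^1$, $\tilde\gamma^1=0$, and for $l=2,\ldots,L+1$ $$\tilde W^l=\Big(\prod_{s=1}^{l-1}W^{s+1}\,\mathrm{diag}\Big(\sum_{i\in[k_s]}u^{i,s}\alpha_i^s\Big)\Big)W^1,$$ $$\tilde\gamma^l=\sum_{s=2}^{l}W^l\Big(\prod_{t=s}^{l-1}\mathrm{diag}\Big(\sum_{i\in[k_t]}u^{i,t}\alpha_i^t\Big)W^t\Big)\Big(\sum_{i\in[k_{s-1}]}u^{i,s-1}\gamma_i^{s-1}\Big).$$ *)

theory Defs
  imports
    "Jordan_Normal_Form.Matrix"
    "HOL-Library.FuncSet"
    "HOL-Library.Extended_Real"
begin

text \<open>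
  Vectors and matrices are those of \<^theory>\<open>Jordan_Normal_Form.Matrix\<close>: \<open>\<real>\<^sup>n\<close> is
  \<open>carrier_vec n\<close>, and the coordinates of a vector are numbered from 0. Layers, affine pieces and
  activation patterns are numbered from 1, and \<open>d l\<close> is the width of layer \<open>l\<close>, \<open>d 0\<close> being the
  input dimension.
\<close>

definition is_norm :: "nat \<Rightarrow> (real vec \<Rightarrow> real) \<Rightarrow> bool" where
  "is_norm n nrm \<longleftrightarrow>
     (\<forall>v\<in>carrier_vec n. 0 \<le> nrm v) \<and>
     (\<forall>v\<in>carrier_vec n. nrm v = 0 \<longleftrightarrow> v = 0\<^sub>v n) \<and>
     (\<forall>a. \<forall>v\<in>carrier_vec n. nrm (a \<cdot>\<^sub>v v) = \<bar>a\<bar> * nrm v) \<and>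
     (\<forall>v\<in>carrier_vec n. \<forall>w\<in>carrier_vec n. nrm (v + w) \<le> nrm v + nrm w)"

definition piecewise_affine_activation ::
  "(real \<Rightarrow> real) \<Rightarrow> nat \<Rightarrow> (nat \<Rightarrow> real) \<Rightarrow> (nat \<Rightarrow> real) \<Rightarrow> (nat \<Rightarrow> ereal) \<Rightarrow> (nat \<Rightarrow> ereal) \<Rightarrow> bool"
where
  "piecewise_affine_activation \<sigma> k \<alpha> \<gamma> lo hi \<longleftrightarrow>
     continuous_on UNIV \<sigma> \<and>
     1 \<le> k \<and>
     (\<forall>i\<in>{1..k}. lo i < hi i) \<and>
     (\<forall>i\<in>{1..<k}. hi i = lo (i + 1)) \<and>
     lo 1 = -\<infinity> \<and>
     hi k = \<infinity> \<and>
     (\<forall>i\<in>{1..k}. \<forall>w. lo i \<le> ereal w \<and> ereal w \<le> hi i \<longrightarrow> \<sigma> w = \<alpha> i * w + \<gamma> i)"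

text \<open>\<open>network W \<sigma> l c\<close> is the output of the first \<open>l\<close> layers on input \<open>c\<close>.\<close>

fun network :: "(nat \<Rightarrow> real mat) \<Rightarrow> (nat \<Rightarrow> real \<Rightarrow> real) \<Rightarrow> nat \<Rightarrow> real vec \<Rightarrow> real vec" where
  "network W \<sigma> 0 c = c"
| "network W \<sigma> (Suc l) c = map_vec (\<sigma> (Suc l)) (W (Suc l) *\<^sub>v network W \<sigma> l c)"

definition U_set ::
  "nat \<Rightarrow> (nat \<Rightarrow> nat) \<Rightarrow> (nat \<Rightarrow> real \<Rightarrow> real) \<Rightarrow> (real vec \<Rightarrow> real) \<Rightarrow>
   (nat \<Rightarrow> real mat) \<Rightarrow> real vec \<Rightarrow> real \<Rightarrow> real vec set" where
  "U_set L d \<sigma> nrm W cbar R = {c \<in> carrier_vec (d 0). nrm (network W \<sigma> L c - cbar) \<le> R}"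

text \<open>
  A pattern \<open>u\<close> assigns to layer \<open>l\<close> and piece \<open>i\<close> the 0/1 vector \<open>u l i\<close> marking the neurons of
  layer \<open>l\<close> that operate in piece \<open>i\<close>.
\<close>

definition activation_patterns ::
  "nat \<Rightarrow> (nat \<Rightarrow> nat) \<Rightarrow> (nat \<Rightarrow> nat) \<Rightarrow> (nat \<Rightarrow> nat \<Rightarrow> real vec) set" where
  "activation_patterns L d k =
     {u \<in> (\<Pi>\<^sub>E l\<in>{1..L}. \<Pi>\<^sub>E i\<in>{1..k l}. {v \<in> carrier_vec (d l). \<forall>j<d l. v $ j \<in> {0, 1}}).
        \<forall>l\<in>{1..L}. finsum_vec TYPE(real) (d l) (u l) {1..k l} = vec (d l) (\<lambda>_. 1)}"

text \<open>The vectors \<open>\<Sum>\<^sub>i u\<^sup>i a\<^sub>i\<close>, for real and for extended real coefficients \<open>a\<^sub>i\<close>.\<close>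

definition pattern_sum :: "nat \<Rightarrow> nat \<Rightarrow> (nat \<Rightarrow> real vec) \<Rightarrow> (nat \<Rightarrow> real) \<Rightarrow> real vec" where
  "pattern_sum n k u a = finsum_vec TYPE(real) n (\<lambda>i. a i \<cdot>\<^sub>v u i) {1..k}"

text \<open>The multiplication of \<^typ>\<open>ereal\<close> satisfies \<open>\<plusminus>\<infinity> * 0 = 0\<close>, as required here.\<close>

definition pattern_sum_ereal :: "nat \<Rightarrow> nat \<Rightarrow> (nat \<Rightarrow> real vec) \<Rightarrow> (nat \<Rightarrow> ereal) \<Rightarrow> ereal vec" where
  "pattern_sum_ereal n k u b = finsum_vec TYPE(ereal) n (\<lambda>i. b i \<cdot>\<^sub>v map_vec ereal (u i)) {1..k}"

definition diag_of :: "real vec \<Rightarrow> real mat" where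
  "diag_of v = mat_diag (dim_vec v) (\<lambda>j. v $ j)"

text \<open>
  \<open>ordered_prod n M a b\<close> is \<open>M b * M (b - 1) * \<dots> * M a\<close>, the factor with the largest index on the
  left; \<open>n\<close> is the number of columns of \<open>M a\<close>, and the empty product (\<open>b < a\<close>) is the identity of
  size \<open>n\<close>.
\<close>

definition ordered_prod :: "nat \<Rightarrow> (nat \<Rightarrow> real mat) \<Rightarrow> nat \<Rightarrow> nat \<Rightarrow> real mat" where
  "ordered_prod n M a b = fold (\<lambda>i A. M i * A) [a..<b + 1] (1\<^sub>m n)"

definition W_ext :: "nat \<Rightarrow> (nat \<Rightarrow> nat) \<Rightarrow> (nat \<Rightarrow> real mat) \<Rightarrow> nat \<Rightarrow> real mat" where
  "W_ext L d W = W(L + 1 := 1\<^sub>m (d L))"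

definition slope_diag ::
  "(nat \<Rightarrow> nat) \<Rightarrow> (nat \<Rightarrow> nat) \<Rightarrow> (nat \<Rightarrow> nat \<Rightarrow> real) \<Rightarrow> (nat \<Rightarrow> nat \<Rightarrow> real vec) \<Rightarrow> nat \<Rightarrow> real mat" where
  "slope_diag d k \<alpha> u l = diag_of (pattern_sum (d l) (k l) (u l) (\<alpha> l))"

definition W_tilde ::
  "nat \<Rightarrow> (nat \<Rightarrow> nat) \<Rightarrow> (nat \<Rightarrow> nat) \<Rightarrow> (nat \<Rightarrow> nat \<Rightarrow> real) \<Rightarrow> (nat \<Rightarrow> real mat) \<Rightarrow>
   (nat \<Rightarrow> nat \<Rightarrow> real vec) \<Rightarrow> nat \<Rightarrow> real mat" where
  "W_tilde L d k \<alpha> W u l =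
     (if l = 1 then W 1
      else ordered_prod (d 1) (\<lambda>s. W_ext L d W (s + 1) * slope_diag d k \<alpha> u s) 1 (l - 1) * W 1)"

definition \<gamma>_tilde ::
  "nat \<Rightarrow> (nat \<Rightarrow> nat) \<Rightarrow> (nat \<Rightarrow> nat) \<Rightarrow> (nat \<Rightarrow> nat \<Rightarrow> real) \<Rightarrow> (nat \<Rightarrow> nat \<Rightarrow> real) \<Rightarrow>
   (nat \<Rightarrow> real mat) \<Rightarrow> (nat \<Rightarrow> nat \<Rightarrow> real vec) \<Rightarrow> nat \<Rightarrow> real vec" where
  "\<gamma>_tilde L d k \<alpha> \<gamma> W u l =
     (if l = 1 then 0\<^sub>v (d 1)
      else finsum_vec TYPE(real) (dim_row (W_ext L d W l))
        (\<lambda>s. W_ext L d W l *\<^sub>v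
           (ordered_prod (d (s - 1)) (\<lambda>t. slope_diag d k \<alpha> u t * W_ext L d W t) s (l - 1) *\<^sub>v
             pattern_sum (d (s - 1)) (k (s - 1)) (u (s - 1)) (\<gamma> (s - 1))))
        {2..l})"

text \<open>
  The order relation \<open><\<close> that \<^theory>\<open>Jordan_Normal_Form.Matrix\<close> puts on vectors is the strict part
  of the componentwise \<open>\<le>\<close>, not the componentwise \<open><\<close>; so both inequalities are spelled out in
  coordinates.
\<close>

definition P_set ::
  "nat \<Rightarrow> (nat \<Rightarrow> nat) \<Rightarrow> (nat \<Rightarrow> nat) \<Rightarrow> (nat \<Rightarrow> nat \<Rightarrow> real) \<Rightarrow> (nat \<Rightarrow> nat \<Rightarrow> real) \<Rightarrow>
   (nat \<Rightarrow> nat \<Rightarrow> ereal) \<Rightarrow> (nat \<Rightarrow> nat \<Rightarrow> ereal) \<Rightarrow> (real vec \<Rightarrow> real) \<Rightarrow>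
   (nat \<Rightarrow> real mat) \<Rightarrow> (nat \<Rightarrow> nat \<Rightarrow> real vec) \<Rightarrow> real vec \<Rightarrow> real \<Rightarrow> real vec set" where
  "P_set L d k \<alpha> \<gamma> lo hi nrm W u cbar R =
     {c \<in> carrier_vec (d 0).
        (\<forall>l\<in>{1..L}. \<forall>j<d l.
           ereal ((W_tilde L d k \<alpha> W u l *\<^sub>v c + \<gamma>_tilde L d k \<alpha> \<gamma> W u l) $ j)
             < pattern_sum_ereal (d l) (k l) (u l) (hi l) $ j) \<and>
        (\<forall>l\<in>{1..L}. \<forall>j<d l.
           ereal ((W_tilde L d k \<alpha> W u l *\<^sub>v c + \<gamma>_tilde L d k \<alpha> \<gamma> W u l) $ j)
             \<ge> pattern_sum_ereal (d l) (k l) (u l) (lo l) $ j) \<and>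
        nrm (W_tilde L d k \<alpha> W u (L + 1) *\<^sub>v c + \<gamma>_tilde L d k \<alpha> \<gamma> W u (L + 1) - cbar) \<le> R}"

end

theory Submission
  imports Defs
begin

text \<open>
  The affine map \<open>W_tilde l *\<^sub>v c + \<gamma>_tilde l\<close> satisfies the recursion of the network in which every activation
  is replaced by the affine piece selected by \<open>u\<close>. Hence, if \<open>u\<close> selects for every neuron a piece
  that contains its input, the two agree by induction on the layer. The half-open intervals
  \<open>[lo i, hi i)\<close> cover the line, so every input of the network has such a pattern \<open>u\<close>.
\<close>

subsection \<open>Sums of vectors\<close>

lemma finsum_vec_cong:
  fixes f g :: "'i \<Rightarrow> 'a :: comm_monoid_add vec"
  assumes "g \<in> F \<rightarrow> carrier_vec n" and "\<And>i. i \<in> F \<Longrightarrow> f i = g i"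
  shows "finsum_vec TYPE('a) n f F = finsum_vec TYPE('a) n g F"
  unfolding finsum_vec_def
  by (rule comm_monoid.finprod_cong'[OF comm_monoid_vec refl])
    (use assms in \<open>auto simp: monoid_vec_simps\<close>)

lemma mult_mat_vec_zero:
  fixes A :: "'a :: semiring_0 mat"
  assumes "A \<in> carrier_mat m n"
  shows "A *\<^sub>v 0\<^sub>v n = 0\<^sub>v m"
  using assms by (intro eq_vecI) (auto simp: scalar_prod_def)

lemma mult_mat_vec_finsum_vec:
  fixes A :: "'a :: semiring_0 mat"
  assumes "finite F" and A: "A \<in> carrier_mat m n" and "f \<in> F \<rightarrow> carrier_vec n"
  shows "A *\<^sub>v finsum_vec TYPE('a) n f F = finsum_vec TYPE('a) m (\<lambda>i. A *\<^sub>v f i) F"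
  using assms(1,3)
proof (induction F)
  case empty
  then show ?case by (simp add: finsum_vec_empty mult_mat_vec_zero[OF A])
next
  case (insert x F)
  have f: "f \<in> F \<rightarrow> carrier_vec n" "f x \<in> carrier_vec n"
    using insert.prems by auto
  have g: "(\<lambda>i. A *\<^sub>v f i) \<in> F \<rightarrow> carrier_vec m" "A *\<^sub>v f x \<in> carrier_vec m"
    using mult_mat_vec_carrier[OF A] f by (auto intro: Pi_I)
  show ?case
    unfolding finsum_vec_insert[OF insert.hyps f] finsum_vec_insert[OF insert.hyps g]
    using mult_add_distrib_mat_vec[OF A f(2) finsum_vec_closed[OF f(1)]] insert.IH[OF f(1)]
    by simp
qed

text \<open>Meant for \<open>A\<close>, \<open>B\<close>, \<open>C\<close> being
  \<open>V (Suc l)\<close>, \<open>D l\<close>, \<open>Wt l\<close>: the linear part and the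
  constant part on the right are then those of \<open>Wt_Suc\<close> and
  \<open>gt_Suc\<close>.\<close>

lemma mult_mat_vec_affine:
  fixes A :: "'a :: comm_semiring_0 mat"
  assumes A: "A \<in> carrier_mat m n" and B: "B \<in> carrier_mat n p" and C: "C \<in> carrier_mat p q"
    and c: "c \<in> carrier_vec q" and "v \<in> carrier_vec p" "w \<in> carrier_vec n"
  shows "A *\<^sub>v (B *\<^sub>v (C *\<^sub>v c + v) + w) = (A * B) * C *\<^sub>v c + A *\<^sub>v (B *\<^sub>v v + w)"
proof -
  have "A *\<^sub>v (B *\<^sub>v (C *\<^sub>v c + v) + w) = A *\<^sub>v (B *\<^sub>v (C *\<^sub>v c) + (B *\<^sub>v v + w))"
    using assms by (simp add: mult_add_distrib_mat_vec[of B n p] assoc_add_vec[of _ n])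
  also have "\<dots> = A *\<^sub>v (B *\<^sub>v (C *\<^sub>v c)) + A *\<^sub>v (B *\<^sub>v v + w)"
    using assms by (intro mult_add_distrib_mat_vec[of A m n]) auto
  also have "A *\<^sub>v (B *\<^sub>v (C *\<^sub>v c)) = (A * B) * C *\<^sub>v c"
    using assoc_mult_mat_vec[OF mult_carrier_mat[OF A B] C c]
      assoc_mult_mat_vec[OF A B mult_mat_vec_carrier[OF C c]] by simp
  finally show ?thesis .
qed

subsection \<open>Activation patterns and pieces\<close>

text \<open>Some value is 1, since otherwise the sum vanishes. Removing it leaves nonnegative terms
  with sum 0, so all others are 0.\<close>

lemma sum_01_eq_1_imp_indicator:
  fixes f :: "'i \<Rightarrow> 'a :: linordered_semidom"
  assumes "finite I" and "\<And>i. i \<in> I \<Longrightarrow> f i \<in> {0, 1}" and "sum f I = 1"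
  obtains p where "p \<in> I" and "\<And>i. i \<in> I \<Longrightarrow> f i = of_bool (i = p)"
proof -
  obtain p where p: "p \<in> I" "f p = 1"
    using assms by (metis empty_iff insert_iff sum.neutral zero_neq_one)
  have "sum f I = 1 + sum f (I - {p})"
    using p assms(1) by (simp add: sum.remove)
  then have "sum f (I - {p}) = 0"
    using assms(3) by simp
  moreover have "\<forall>i\<in>I - {p}. 0 \<le> f i"
    using assms(2) by fastforce
  ultimately have "\<forall>i\<in>I - {p}. f i = 0"
    using assms(1) sum_nonneg_eq_0_iff[of "I - {p}" f] by blast
  then show thesis
    using p by (intro that[of p]) auto
qed

text \<open>Induction on the number of pieces: \<open>w\<close> is either at or above the start of
  the last piece, or in the range of the earlier ones.\<close>

lemma exists_half_open_piece:
  fixes lo hi :: "nat \<Rightarrow> 'a :: linorder"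
  assumes "1 \<le> k" and "\<And>i. i \<in> {1..<k} \<Longrightarrow> hi i = lo (i + 1)"
    and "lo 1 \<le> w" and "w < hi k"
  shows "\<exists>p\<in>{1..k}. lo p \<le> w \<and> w < hi p"
  using assms
proof (induction k rule: nat_induct_at_least)
  case base
  then show ?case by auto
next
  case (Suc n)
  show ?case
  proof (cases "lo (Suc n) \<le> w")
    case True
    then show ?thesis using Suc.prems by auto
  next
    case False
    \<comment> \<open>The last piece starts where piece \<open>n\<close> ends, so being below its
      start gives the bound required by the induction hypothesis.\<close>
    then have "w < hi n" using Suc.hyps Suc.prems(1)[of n] by auto
    then have "\<exists>p\<in>{1..n}. lo p \<le> w \<and> w < hi p"
      using Suc by auto
    then show ?thesis by fastforce
  qed
qed

section \<open>Coordinates of pattern sums\<close>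

lemma pattern_sum_carrier:
  assumes "\<And>i. i \<in> {1..k} \<Longrightarrow> u i \<in> carrier_vec n"
  shows "pattern_sum n k u a \<in> carrier_vec n"
  unfolding pattern_sum_def using assms by (intro finsum_vec_closed) auto

lemma pattern_sum_index:
  assumes "\<And>i. i \<in> {1..k} \<Longrightarrow> u i \<in> carrier_vec n" and "j < n" and "p \<in> {1..k}"
    and "\<And>i. i \<in> {1..k} \<Longrightarrow> u i $ j = of_bool (i = p)"
  shows "pattern_sum n k u a $ j = a p"
proof -
  have "pattern_sum n k u a $ j = (\<Sum>i\<in>{1..k}. (a i \<cdot>\<^sub>v u i) $ j)"
    unfolding pattern_sum_def using assms(1,2) by (intro index_finsum_vec) auto
  also have "\<dots> = (\<Sum>i\<in>{1..k}. if i = p then a i else 0)"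
    using assms(2,4) carrier_vecD[OF assms(1)] by (intro sum.cong refl) simp
  also have "\<dots> = a p"
    using assms(3) by simp
  finally show ?thesis .
qed

text \<open>The bounds of the unselected pieces may be infinite; they still drop out, because
  \<open>ereal\<close> multiplication by 0 gives 0.\<close>

lemma pattern_sum_ereal_index:
  assumes "\<And>i. i \<in> {1..k} \<Longrightarrow> u i \<in> carrier_vec n" and "j < n" and "p \<in> {1..k}"
    and "\<And>i. i \<in> {1..k} \<Longrightarrow> u i $ j = of_bool (i = p)"
  shows "pattern_sum_ereal n k u b $ j = b p"
proof -
  have "pattern_sum_ereal n k u b $ j = (\<Sum>i\<in>{1..k}. (b i \<cdot>\<^sub>v map_vec ereal (u i)) $ j)"
    unfolding pattern_sum_ereal_def using assms(1,2) by (intro index_finsum_vec) auto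
  also have "\<dots> = (\<Sum>i\<in>{1..k}. if i = p then b i else 0)"
    using assms(2,4) carrier_vecD[OF assms(1)] by (intro sum.cong refl) simp
  also have "\<dots> = b p"
    using assms(3) by simp
  finally show ?thesis .
qed

lemma activation_pattern_carrier:
  assumes "u \<in> activation_patterns L d k" and "l \<in> {1..L}" and "i \<in> {1..k l}"
  shows "u l i \<in> carrier_vec (d l)"
  using assms by (auto simp: activation_patterns_def PiE_iff)

text \<open>Coordinate \<open>j\<close> of the vector equation for layer \<open>l\<close> says that
  numbers in {0, 1} sum to 1.\<close>

lemma activation_pattern_selects:
  assumes u: "u \<in> activation_patterns L d k" and l: "l \<in> {1..L}" and j: "j < d l"
  obtains p where "p \<in> {1..k l}" and "\<And>i. i \<in> {1..k l} \<Longrightarrow> u l i $ j = of_bool (i = p)"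
proof -
  have "(\<Sum>i\<in>{1..k l}. u l i $ j) = finsum_vec TYPE(real) (d l) (u l) {1..k l} $ j"
    using activation_pattern_carrier[OF u l] j by (intro index_finsum_vec[symmetric]) auto
  also have "\<dots> = 1"
    using u l j by (auto simp: activation_patterns_def)
  finally have "(\<Sum>i\<in>{1..k l}. u l i $ j) = 1" .
  moreover have "u l i $ j \<in> {0, 1}" if "i \<in> {1..k l}" for i
    using u l j that by (auto simp: activation_patterns_def PiE_iff)
  ultimately show thesis
    using that by (metis (no_types, lifting) finite_atLeastAtMost sum_01_eq_1_imp_indicator)
qed

text \<open>Here \<open>p l j\<close> is the piece prescribed for neuron \<open>j\<close> of layer
  \<open>l\<close>. The restricted abstractions make the pattern extensional, as the function spaces
  in \<open>activation_patterns\<close> demand.\<close>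

definition pattern_of ::
  "nat \<Rightarrow> (nat \<Rightarrow> nat) \<Rightarrow> (nat \<Rightarrow> nat) \<Rightarrow> (nat \<Rightarrow> nat \<Rightarrow> nat) \<Rightarrow> nat \<Rightarrow> nat \<Rightarrow> real vec" where
  "pattern_of L d k p =
     (\<lambda>l\<in>{1..L}. \<lambda>i\<in>{1..k l}. vec (d l) (\<lambda>j. of_bool (i = p l j)))"

lemma pattern_of_in_activation_patterns:
  assumes "\<And>l j. l \<in> {1..L} \<Longrightarrow> j < d l \<Longrightarrow> p l j \<in> {1..k l}"
  shows "pattern_of L d k p \<in> activation_patterns L d k"
proof -
  have "finsum_vec TYPE(real) (d l) (pattern_of L d k p l) {1..k l} = vec (d l) (\<lambda>_. 1)"
    if l: "l \<in> {1..L}" for l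
  proof (rule eq_vecI)
    have car: "pattern_of L d k p l \<in> {1..k l} \<rightarrow> carrier_vec (d l)"
      using l by (auto simp: pattern_of_def)
    then show "dim_vec (finsum_vec TYPE(real) (d l) (pattern_of L d k p l) {1..k l})
        = dim_vec (vec (d l) (\<lambda>_. 1 :: real))"
      using finsum_vec_closed[OF car] by simp
    fix j assume "j < dim_vec (vec (d l) (\<lambda>_. 1 :: real))"
    then have j: "j < d l" by simp
    have "finsum_vec TYPE(real) (d l) (pattern_of L d k p l) {1..k l} $ j
        = (\<Sum>i\<in>{1..k l}. pattern_of L d k p l i $ j)"
      by (rule index_finsum_vec[OF _ j car]) simp
    also have "\<dots> = (\<Sum>i\<in>{1..k l}. if i = p l j then 1 else 0)"
      using l j by (intro sum.cong refl) (auto simp: pattern_of_def)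
    also have "\<dots> = 1"
      using assms[OF l j] by simp
    finally show "finsum_vec TYPE(real) (d l) (pattern_of L d k p l) {1..k l} $ j
        = vec (d l) (\<lambda>_. 1 :: real) $ j"
      using j by simp
  qed
  then show ?thesis
    by (auto simp: activation_patterns_def pattern_of_def PiE_iff extensional_def)
qed

subsection \<open>The recursion of the affine maps\<close>

lemma ordered_prod_empty [simp]: "b < a \<Longrightarrow> ordered_prod n M a b = 1\<^sub>m n"
  by (simp add: ordered_prod_def)

lemma ordered_prod_Suc:
  "a \<le> Suc b \<Longrightarrow> ordered_prod n M a (Suc b) = M (Suc b) * ordered_prod n M a b"
  by (simp add: ordered_prod_def)

text \<open>The sequence \<open>e\<close> lists the dimensions between consecutive factors, so they
  telescope. The case \<open>a = Suc b\<close> is the empty product, an identity of size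
  \<open>e a\<close>.\<close>

lemma ordered_prod_carrier:
  assumes "a \<le> Suc b" and "\<And>i. i \<in> {a..b} \<Longrightarrow> M i \<in> carrier_mat (e (Suc i)) (e i)"
  shows "ordered_prod (e a) M a b \<in> carrier_mat (e (Suc b)) (e a)"
  using assms
proof (induction b)
  case 0
  then show ?case by (cases a) (auto simp: ordered_prod_def)
next
  case (Suc b)
  show ?case
  proof (cases "a = Suc (Suc b)")
    case True
    then show ?thesis by simp
  next
    case False
    then show ?thesis
      using Suc by (auto simp: ordered_prod_Suc intro!: mult_carrier_mat)
  qed
qed

lemma slope_diag_carrier:
  assumes "\<And>i. i \<in> {1..k l} \<Longrightarrow> u l i \<in> carrier_vec (d l)"
  shows "slope_diag d k \<alpha> u l \<in> carrier_mat (d l) (d l)"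
proof -
  have "dim_vec (pattern_sum (d l) (k l) (u l) (\<alpha> l)) = d l"
    using pattern_sum_carrier[OF assms] by (rule carrier_vecD)
  then show ?thesis
    by (simp add: slope_diag_def diag_of_def)
qed

lemma diag_of_mult_vec:
  assumes "v \<in> carrier_vec (dim_vec w)"
  shows "diag_of w *\<^sub>v v = vec (dim_vec w) (\<lambda>j. w $ j * v $ j)"
proof (rule eq_vecI)
  fix j assume "j < dim_vec (vec (dim_vec w) (\<lambda>j. w $ j * v $ j))"
  then have j: "j < dim_vec w" by simp
  have "(diag_of w *\<^sub>v v) $ j = (\<Sum>i\<in>{0..<dim_vec w}. (if j = i then w $ i else 0) * v $ i)"
    using assms j by (simp add: diag_of_def mat_diag_def scalar_prod_def)
  also have "\<dots> = (\<Sum>i\<in>{0..<dim_vec w}. if i = j then w $ j * v $ j else 0)"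
    by (intro sum.cong refl) simp
  also have "\<dots> = w $ j * v $ j"
    using j by simp
  finally show "(diag_of w *\<^sub>v v) $ j = vec (dim_vec w) (\<lambda>j. w $ j * v $ j) $ j"
    using j by simp
qed (simp add: diag_of_def mat_diag_def)

text \<open>One pattern \<open>u\<close> is fixed. The theorem interprets the locale once per
  inclusion: with a pattern built from the input, and with a given member of the union.\<close>

locale patterned_network =
  fixes L :: nat and d k :: "nat \<Rightarrow> nat" and W :: "nat \<Rightarrow> real mat"
    and \<sigma> :: "nat \<Rightarrow> real \<Rightarrow> real" and \<alpha> \<gamma> :: "nat \<Rightarrow> nat \<Rightarrow> real"
    and lo hi :: "nat \<Rightarrow> nat \<Rightarrow> ereal" and u :: "nat \<Rightarrow> nat \<Rightarrow> real vec"
  assumes L_ge_1: "1 \<le> L"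
    and W_carrier: "l \<in> {1..L} \<Longrightarrow> W l \<in> carrier_mat (d l) (d (l - 1))"
    and activation: "l \<in> {1..L} \<Longrightarrow>
      piecewise_affine_activation (\<sigma> l) (k l) (\<alpha> l) (\<gamma> l) (lo l) (hi l)"
    and pattern: "u \<in> activation_patterns L d k"
begin

abbreviation V where "V \<equiv> W_ext L d W"
abbreviation D where "D \<equiv> slope_diag d k \<alpha> u"
abbreviation g where "g l \<equiv> pattern_sum (d l) (k l) (u l) (\<gamma> l)"
abbreviation Wt where "Wt \<equiv> W_tilde L d k \<alpha> W u"
abbreviation gt where "gt \<equiv> \<gamma>_tilde L d k \<alpha> \<gamma> W u"

text \<open>Output width of layer \<open>l\<close>, the additional identity layer \<open>L + 1\<close> included.\<close>

definition width where "width l = d (min l L)"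

lemma width_eq [simp]: "l \<le> L \<Longrightarrow> width l = d l"
  by (simp add: width_def min_absorb1)

text \<open>Since \<open>width (L + 1)\<close> and \<open>width L\<close> are both
  \<open>d L\<close>, the appended identity obeys the same dimension rule as the weights.\<close>

lemma V_carrier: "l \<in> {1..L + 1} \<Longrightarrow> V l \<in> carrier_mat (width l) (width (l - 1))"
  using W_carrier[of l] by (cases "l = L + 1") (auto simp: W_ext_def width_def)

lemma D_carrier: "l \<in> {1..L} \<Longrightarrow> D l \<in> carrier_mat (width l) (width l)"
  using slope_diag_carrier[of k l u d] activation_pattern_carrier[OF pattern] by simp

lemma g_carrier: "l \<in> {1..L} \<Longrightarrow> g l \<in> carrier_vec (width l)"
  using pattern_sum_carrier[OF activation_pattern_carrier[OF pattern]] by simp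

lemma dim_g: "l \<in> {1..L} \<Longrightarrow> dim_vec (g l) = d l"
  using g_carrier[of l] by auto

lemma Wt_1: "Wt 1 = W 1" and gt_1: "gt 1 = 0\<^sub>v (d 1)"
  by (simp_all add: W_tilde_def \<gamma>_tilde_def)

section \<open>Recursion of the linear parts\<close>

lemma VD_prod_carrier:
  assumes "l \<in> {1..L}"
  shows "ordered_prod (width 1) (\<lambda>s. V (s + 1) * D s) 1 l \<in> carrier_mat (width (Suc l)) (width 1)"
proof (rule ordered_prod_carrier)
  fix i assume i: "i \<in> {1..l}"
  show "V (i + 1) * D i \<in> carrier_mat (width (Suc i)) (width i)"
    using V_carrier[of "i + 1"] D_carrier[of i] i assms by (intro mult_carrier_mat[of _ _ "width i"]) auto
qed simp

lemma Wt_carrier: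
  assumes "l \<in> {1..L + 1}"
  shows "Wt l \<in> carrier_mat (width l) (width 0)"
proof (cases "l = 1")
  case True
  then show ?thesis using W_carrier[of 1] L_ge_1 Wt_1 by simp
next
  case False
  then obtain m where m: "l = Suc m" "m \<in> {1..L}"
    using assms by (cases l) auto
  then show ?thesis
    using mult_carrier_mat[OF VD_prod_carrier[OF m(2)], of "W 1" "width 0"] W_carrier[of 1] L_ge_1
    by (simp add: W_tilde_def)
qed

lemma Wt_Suc:
  assumes l: "l \<in> {1..L}"
  shows "Wt (Suc l) = (V (Suc l) * D l) * Wt l"
proof -
  have W1: "W 1 \<in> carrier_mat (width 1) (width 0)"
    using W_carrier[of 1] L_ge_1 by auto
  have VD: "V (Suc l) * D l \<in> carrier_mat (width (Suc l)) (width l)"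
    using V_carrier[of "Suc l"] D_carrier[of l] l by (intro mult_carrier_mat[of _ _ "width l"]) auto
  obtain m where m: "l = Suc m"
    using l by (cases l) auto
  show ?thesis
  proof (cases m)
    \<comment> \<open>Here \<open>l = 1\<close>: \<open>Wt l\<close> is \<open>W 1\<close> by the
      separate clause of its definition, and the product in \<open>Wt (Suc l)\<close> has a single
      factor.\<close>
    case 0
    then show ?thesis
      using m right_mult_one_mat[OF VD] L_ge_1 by (simp add: W_tilde_def ordered_prod_def)
  next
    case (Suc n)
    have "ordered_prod (width 1) (\<lambda>s. V (s + 1) * D s) 1 m \<in> carrier_mat (width l) (width 1)"
      using VD_prod_carrier[of m] l m Suc by simp
    then show ?thesis
      using assoc_mult_mat[OF VD _ W1] L_ge_1
      by (simp add: W_tilde_def m ordered_prod_Suc Suc)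
  qed
qed

section \<open>Recursion of the constant parts\<close>

text \<open>The summand of index \<open>s\<close> of \<open>\<gamma>_tilde l\<close>, before the multiplication by \<open>V l\<close>.\<close>

definition summand where
  "summand l s =
     ordered_prod (d (s - 1)) (\<lambda>t. D t * V t) s (l - 1) *\<^sub>v g (s - 1)"

lemma DV_prod_carrier:
  assumes "s \<in> {2..l}" "l \<le> L + 1"
  shows "ordered_prod (d (s - 1)) (\<lambda>t. D t * V t) s (l - 1) \<in> carrier_mat (width (l - 1)) (width (s - 1))"
proof -
  have "ordered_prod (width (s - 1)) (\<lambda>t. D t * V t) s (l - 1)
      \<in> carrier_mat (width (Suc (l - 1) - 1)) (width (s - 1))"
  \<comment> \<open>Factor \<open>D i * V i\<close> leads from the width of layer
    \<open>i - 1\<close> to that of layer \<open>i\<close>, hence the shifted dimension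
    sequence.\<close>
  proof (rule ordered_prod_carrier[where e = "\<lambda>i. width (i - 1)"])
    fix i assume i: "i \<in> {s..l - 1}"
    show "D i * V i \<in> carrier_mat (width (Suc i - 1)) (width (i - 1))"
      using V_carrier[of i] D_carrier[of i] i assms by (intro mult_carrier_mat[of _ _ "width i"]) auto
  qed (use assms in auto)
  then show ?thesis using assms by auto
qed

lemma summand_carrier:
  assumes "s \<in> {2..l}" "l \<le> L + 1"
  shows "summand l s \<in> carrier_vec (width (l - 1))"
proof -
  have "g (s - 1) \<in> carrier_vec (width (s - 1))"
    using assms by (intro g_carrier) auto
  then show ?thesis
    using DV_prod_carrier[OF assms] unfolding summand_def by (rule mult_mat_vec_carrier[rotated])
qed

text \<open>The product runs from \<open>Suc l\<close> to \<open>l\<close>, so it is empty and only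
  the intercepts of layer \<open>l\<close> remain.\<close>

lemma summand_Suc_self:
  assumes "l \<in> {1..L}"
  shows "summand (Suc l) (Suc l) = g l"
  using one_mult_mat_vec[OF g_carrier[OF assms]] assms by (simp add: summand_def)

text \<open>The upper end of the product moves from \<open>l - 1\<close> to \<open>l\<close>, which
  adds the factor \<open>D l * V l\<close> on the left.\<close>

lemma summand_Suc:
  assumes "s \<in> {2..l}" "l \<le> L"
  shows "summand (Suc l) s = D l *\<^sub>v (V l *\<^sub>v summand l s)"
proof -
  have l: "l \<in> {1..L}" "l \<in> {1..L + 1}"
    using assms by auto
  have P: "ordered_prod (d (s - 1)) (\<lambda>t. D t * V t) s (l - 1)
      \<in> carrier_mat (width (l - 1)) (width (s - 1))"
    using DV_prod_carrier assms by auto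
  have gs: "g (s - 1) \<in> carrier_vec (width (s - 1))"
    using assms by (intro g_carrier) auto
  have "ordered_prod (d (s - 1)) (\<lambda>t. D t * V t) s (Suc (l - 1))
      = D l * V l * ordered_prod (d (s - 1)) (\<lambda>t. D t * V t) s (l - 1)"
    using assms by (subst ordered_prod_Suc) auto
  then have "summand (Suc l) s
      = (D l * V l * ordered_prod (d (s - 1)) (\<lambda>t. D t * V t) s (l - 1)) *\<^sub>v g (s - 1)"
    using l by (simp add: summand_def)
  also have "\<dots> = (D l * V l) *\<^sub>v summand l s"
    unfolding summand_def
    using assoc_mult_mat_vec[OF mult_carrier_mat[OF D_carrier[OF l(1)] V_carrier[OF l(2)]] P gs] .
  also have "\<dots> = D l *\<^sub>v (V l *\<^sub>v summand l s)"
    using assoc_mult_mat_vec[OF D_carrier[OF l(1)] V_carrier[OF l(2)]]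
      summand_carrier[OF assms(1)] assms(2) by simp
  finally show ?thesis .
qed

text \<open>The common left factor \<open>V l\<close> is pulled out of the sum. This form also
  covers \<open>l = 1\<close>, where the index range is empty and both sides are 0.\<close>

lemma gt_eq:
  assumes "l \<in> {1..L + 1}"
  shows "gt l = V l *\<^sub>v finsum_vec TYPE(real) (width (l - 1)) (summand l) {2..l}"
proof -
  have V: "V l \<in> carrier_mat (width l) (width (l - 1))"
    by (rule V_carrier[OF assms])
  show ?thesis
  proof (cases "l = 1")
    case True
    then show ?thesis
      using mult_mat_vec_zero[OF V] L_ge_1 gt_1 by (simp add: finsum_vec_empty)
  next
    case False
    have "summand l \<in> {2..l} \<rightarrow> carrier_vec (width (l - 1))"
      using summand_carrier[of _ l] assms by (intro Pi_I) auto
    then have "V l *\<^sub>v finsum_vec TYPE(real) (width (l - 1)) (summand l) {2..l}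
        = finsum_vec TYPE(real) (width l) (\<lambda>s. V l *\<^sub>v summand l s) {2..l}"
      by (intro mult_mat_vec_finsum_vec[OF _ V]) simp_all
    moreover have "dim_row (V l) = width l"
      using V by simp
    ultimately show ?thesis
      using False by (simp add: \<gamma>_tilde_def summand_def)
  qed
qed

lemma sum_summand_carrier:
  assumes "l \<in> {1..L + 1}"
  shows "finsum_vec TYPE(real) (width (l - 1)) (summand l) {2..l} \<in> carrier_vec (width (l - 1))"
  using summand_carrier[of _ l] assms by (intro finsum_vec_closed) auto

lemma gt_carrier: "l \<in> {1..L + 1} \<Longrightarrow> gt l \<in> carrier_vec (width l)"
  using mult_mat_vec_carrier[OF V_carrier sum_summand_carrier] gt_eq by simp

text \<open>Multiplication by \<open>D l * V l\<close> turns each old summand into the new summand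
  of the same index; the one new index \<open>Suc l\<close> contributes \<open>g l\<close>.\<close>

lemma gt_Suc:
  assumes l: "l \<in> {1..L}"
  shows "gt (Suc l) = V (Suc l) *\<^sub>v (D l *\<^sub>v gt l + g l)"
proof -
  have l': "l \<in> {1..L + 1}"
    using l by auto
  have DV: "D l * V l \<in> carrier_mat (width l) (width (l - 1))"
    using D_carrier[OF l] V_carrier[OF l'] by (rule mult_carrier_mat)
  have car: "summand l \<in> {2..l} \<rightarrow> carrier_vec (width (l - 1))"
    using summand_carrier[of _ l] l by auto
  have car': "summand (Suc l) \<in> {2..l} \<rightarrow> carrier_vec (width l)"
    using summand_carrier[of _ "Suc l"] l by auto
  have "D l *\<^sub>v gt l = (D l * V l) *\<^sub>v finsum_vec TYPE(real) (width (l - 1)) (summand l) {2..l}"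
    using gt_eq[OF l'] assoc_mult_mat_vec[OF D_carrier[OF l] V_carrier[OF l']
        sum_summand_carrier[OF l']] by simp
  also have "\<dots> = finsum_vec TYPE(real) (width l) (\<lambda>s. (D l * V l) *\<^sub>v summand l s) {2..l}"
    by (rule mult_mat_vec_finsum_vec[OF _ DV car]) simp
  also have "\<dots> = finsum_vec TYPE(real) (width l) (summand (Suc l)) {2..l}"
  proof (rule finsum_vec_cong[OF car'])
    fix s assume s: "s \<in> {2..l}"
    then show "(D l * V l) *\<^sub>v summand l s = summand (Suc l) s"
      using assoc_mult_mat_vec[OF D_carrier[OF l] V_carrier[OF l']] summand_carrier[OF s]
        summand_Suc[OF s] l by simp
  qed
  finally have *: "D l *\<^sub>v gt l = finsum_vec TYPE(real) (width l) (summand (Suc l)) {2..l}" .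
  have "finsum_vec TYPE(real) (width l) (summand (Suc l)) (insert (Suc l) {2..l})
      = summand (Suc l) (Suc l) + finsum_vec TYPE(real) (width l) (summand (Suc l)) {2..l}"
    using g_carrier[OF l] summand_Suc_self[OF l] by (intro finsum_vec_insert car') auto
  also have "insert (Suc l) {2..l} = {2..Suc l}"
    using l by auto
  also have "summand (Suc l) (Suc l) = g l"
    by (rule summand_Suc_self[OF l])
  also have "g l + finsum_vec TYPE(real) (width l) (summand (Suc l)) {2..l} = D l *\<^sub>v gt l + g l"
    unfolding * using g_carrier[OF l] finsum_vec_closed[OF car'] by (rule comm_add_vec)
  finally show ?thesis
    using gt_eq[of "Suc l"] l by simp
qed

text \<open>This is the recursion of the network's pre-activations with the activation of layer
  \<open>l\<close> replaced by slopes \<open>D l\<close> and intercepts \<open>g l\<close>.\<close>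

lemma affine_Suc:
  assumes l: "l \<in> {1..L}" and c: "c \<in> carrier_vec (d 0)"
  shows "Wt (Suc l) *\<^sub>v c + gt (Suc l) = V (Suc l) *\<^sub>v (D l *\<^sub>v (Wt l *\<^sub>v c + gt l) + g l)"
proof -
  have l': "l \<in> {1..L + 1}" "Suc l \<in> {1..L + 1}"
    using l by auto
  have V: "V (Suc l) \<in> carrier_mat (width (Suc l)) (width l)"
    using V_carrier[OF l'(2)] by simp
  have c': "c \<in> carrier_vec (width 0)"
    using c by simp
  show ?thesis
    unfolding mult_mat_vec_affine[OF V D_carrier[OF l] Wt_carrier[OF l'(1)] c'
        gt_carrier[OF l'(1)] g_carrier[OF l]] Wt_Suc[OF l] gt_Suc[OF l] ..
qed

subsection \<open>Inputs fitting a pattern\<close>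

text \<open>Stated for an arbitrary vector \<open>x\<close>, so that it applies both to the affine
  values, as in \<open>P_set\<close>, and to the pre-activations of the network.\<close>

definition fits where
  "fits l x \<longleftrightarrow> (\<forall>j<d l. ereal (x $ j) < pattern_sum_ereal (d l) (k l) (u l) (hi l) $ j
     \<and> pattern_sum_ereal (d l) (k l) (u l) (lo l) $ j \<le> ereal (x $ j))"

text \<open>At each neuron all pattern sums collapse to the data of the one selected piece, and the
  fit places the input in that piece.\<close>

lemma activation_eq_affine:
  assumes l: "l \<in> {1..L}" and x: "x \<in> carrier_vec (d l)" and fit: "fits l x"
  shows "map_vec (\<sigma> l) x = D l *\<^sub>v x + g l"
proof (rule eq_vecI)
  let ?a = "pattern_sum (d l) (k l) (u l) (\<alpha> l)"
  note car = activation_pattern_carrier[OF pattern l]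
  have a: "dim_vec ?a = d l"
    using pattern_sum_carrier[OF car] by auto
  show "dim_vec (map_vec (\<sigma> l) x) = dim_vec (D l *\<^sub>v x + g l)"
    using x dim_g[OF l] by simp
  fix j assume "j < dim_vec (D l *\<^sub>v x + g l)"
  then have j: "j < d l"
    using dim_g[OF l] by simp
  obtain p where p: "p \<in> {1..k l}" "\<And>i. i \<in> {1..k l} \<Longrightarrow> u l i $ j = of_bool (i = p)"
    using activation_pattern_selects[OF pattern l j] by blast
  \<comment> \<open>The strict upper bound is weakened to reach the closed interval on which the
    affine formula is given.\<close>
  have "lo l p \<le> ereal (x $ j)" "ereal (x $ j) \<le> hi l p"
    using fit j pattern_sum_ereal_index[OF car j p] by (auto simp: fits_def less_imp_le)
  then have "\<sigma> l (x $ j) = \<alpha> l p * x $ j + \<gamma> l p"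
    using activation[OF l] p(1) by (auto simp: piecewise_affine_activation_def)
  then show "map_vec (\<sigma> l) x $ j = (D l *\<^sub>v x + g l) $ j"
    using x j a dim_g[OF l] pattern_sum_index[OF car j p]
    by (simp add: slope_diag_def diag_of_mult_vec)
qed

section \<open>Affine maps and pre-activations\<close>

lemma network_carrier:
  assumes "c \<in> carrier_vec (d 0)" and "l \<le> L"
  shows "network W \<sigma> l c \<in> carrier_vec (d l)"
  using assms(2)
\<comment> \<open>No induction: the length of a matrix-vector product is the number of rows of the
  matrix.\<close>
proof (cases l)
  case (Suc m)
  then show ?thesis
    using carrier_matD(1)[OF W_carrier[of l]] assms(2) by (intro carrier_vecI) simp
qed (simp add: assms(1))

text \<open>The fit at layer \<open>m\<close> may be derived from the equation at layer
  \<open>m\<close>, which the induction has established by then. It can thus come from a fit of the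
  affine values or of the pre-activations, one for each inclusion.\<close>

lemma affine_eq_preactivation:
  assumes c: "c \<in> carrier_vec (d 0)" and "l \<in> {1..L + 1}"
    and "\<And>m. m \<in> {1..<l} \<Longrightarrow> Wt m *\<^sub>v c + gt m = W m *\<^sub>v network W \<sigma> (m - 1) c \<Longrightarrow>
      fits m (W m *\<^sub>v network W \<sigma> (m - 1) c)"
  shows "Wt l *\<^sub>v c + gt l = V l *\<^sub>v network W \<sigma> (l - 1) c"
  using assms(2,3)
proof (induction l)
  case (Suc l)
  show ?case
  proof (cases "l = 0")
    case True
    \<comment> \<open>First layer: \<open>V 1\<close> is \<open>W 1\<close> because \<open>L\<close>
      is at least 1, and \<open>gt 1\<close> is 0.\<close>
    have "W 1 *\<^sub>v c \<in> carrier_vec (d 1)"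
      using carrier_matD(1)[OF W_carrier[of 1]] L_ge_1 by (intro carrier_vecI) simp
    then show ?thesis
      using True L_ge_1 Wt_1 gt_1 by (simp add: W_ext_def)
  next
    case False
    then have l: "l \<in> {1..L}"
      using Suc.prems(1) by auto
    let ?x = "W l *\<^sub>v network W \<sigma> (l - 1) c"
    have x: "?x \<in> carrier_vec (d l)"
      using carrier_matD(1)[OF W_carrier[OF l]] by (intro carrier_vecI) simp
    have "Wt l *\<^sub>v c + gt l = V l *\<^sub>v network W \<sigma> (l - 1) c"
      by (rule Suc.IH, use l in simp, rule Suc.prems(2)) auto
    then have IH: "Wt l *\<^sub>v c + gt l = ?x"
      using l by (simp add: W_ext_def)
    have "fits l ?x"
      by (rule Suc.prems(2)[OF _ IH]) (use l in simp)
    moreover have "network W \<sigma> l c = map_vec (\<sigma> l) ?x"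
      using False by (cases l) auto
    ultimately have "network W \<sigma> l c = D l *\<^sub>v (Wt l *\<^sub>v c + gt l) + g l"
      using activation_eq_affine[OF l x] IH by simp
    then show ?thesis
      using affine_Suc[OF l c] by simp
  qed
qed simp

section \<open>Comparison of \<open>P_set\<close> and \<open>U_set\<close> for a fixed
  pattern\<close>

lemma P_set_eq:
  "P_set L d k \<alpha> \<gamma> lo hi nrm W u cbar R =
     {c \<in> carrier_vec (d 0). (\<forall>l\<in>{1..L}. fits l (Wt l *\<^sub>v c + gt l)) \<and>
        nrm (Wt (L + 1) *\<^sub>v c + gt (L + 1) - cbar) \<le> R}"
  unfolding P_set_def fits_def by auto

text \<open>Layer \<open>L + 1\<close> has identity weights, so its pre-activation is the output of
  the network.\<close>

lemma affine_eq_network: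
  assumes c: "c \<in> carrier_vec (d 0)"
    and "\<And>m. m \<in> {1..L} \<Longrightarrow> Wt m *\<^sub>v c + gt m = W m *\<^sub>v network W \<sigma> (m - 1) c \<Longrightarrow>
      fits m (W m *\<^sub>v network W \<sigma> (m - 1) c)"
  shows "Wt (L + 1) *\<^sub>v c + gt (L + 1) = network W \<sigma> L c"
proof -
  have "Wt (L + 1) *\<^sub>v c + gt (L + 1) = V (L + 1) *\<^sub>v network W \<sigma> (L + 1 - 1) c"
    by (rule affine_eq_preactivation[OF c], simp, rule assms(2)) auto
  then show ?thesis
    using one_mult_mat_vec[OF network_carrier[OF c order_refl]] by (simp add: W_ext_def)
qed

lemma P_set_subset_U_set: "P_set L d k \<alpha> \<gamma> lo hi nrm W u cbar R \<subseteq> U_set L d \<sigma> nrm W cbar R"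
proof
  fix c assume "c \<in> P_set L d k \<alpha> \<gamma> lo hi nrm W u cbar R"
  then have c: "c \<in> carrier_vec (d 0)" and fit: "\<forall>l\<in>{1..L}. fits l (Wt l *\<^sub>v c + gt l)"
    and le: "nrm (Wt (L + 1) *\<^sub>v c + gt (L + 1) - cbar) \<le> R"
    unfolding P_set_eq by auto
  have "Wt (L + 1) *\<^sub>v c + gt (L + 1) = network W \<sigma> L c"
    \<comment> \<open>\<open>P_set\<close> yields the fit of the affine values; the equation
      supplied at layer \<open>m\<close> carries it over to the pre-activation.\<close>
    by (rule affine_eq_network[OF c]) (use fit in metis)
  then show "c \<in> U_set L d \<sigma> nrm W cbar R"
    using c le by (simp add: U_set_def)
qed

text \<open>Fitting pre-activations coincide with the affine values at every layer, so the fit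
  passes to the latter, as \<open>P_set\<close> requires.\<close>

lemma U_set_fits_imp_P_set:
  assumes "c \<in> U_set L d \<sigma> nrm W cbar R"
    and fit: "\<And>l. l \<in> {1..L} \<Longrightarrow> fits l (W l *\<^sub>v network W \<sigma> (l - 1) c)"
  shows "c \<in> P_set L d k \<alpha> \<gamma> lo hi nrm W u cbar R"
proof -
  have c: "c \<in> carrier_vec (d 0)" and le: "nrm (network W \<sigma> L c - cbar) \<le> R"
    using assms(1) by (auto simp: U_set_def)
  have "fits l (Wt l *\<^sub>v c + gt l)" if l: "l \<in> {1..L}" for l
  proof -
    have "Wt l *\<^sub>v c + gt l = V l *\<^sub>v network W \<sigma> (l - 1) c"
      by (rule affine_eq_preactivation[OF c]) (use l in simp, rule fit, use l in simp)
    then show ?thesis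
      using fit[OF l] l by (simp add: W_ext_def)
  qed
  moreover have "Wt (L + 1) *\<^sub>v c + gt (L + 1) = network W \<sigma> L c"
    by (rule affine_eq_network[OF c]) (rule fit)
  ultimately show ?thesis
    unfolding P_set_eq using c le by auto
qed

end

section \<open>The pattern built from an input\<close>

lemma fits_pattern_of:
  assumes "patterned_network L d k W \<sigma> \<alpha> \<gamma> lo hi (pattern_of L d k p)"
    and l: "l \<in> {1..L}"
    and p: "\<And>j. j < d l \<Longrightarrow> p l j \<in> {1..k l} \<and> lo l (p l j) \<le> ereal (x $ j) \<and> ereal (x $ j) < hi l (p l j)"
  shows "patterned_network.fits d k lo hi (pattern_of L d k p) l x"
proof -
  interpret patterned_network L d k W \<sigma> \<alpha> \<gamma> lo hi "pattern_of L d k p"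
    by fact
  \<comment> \<open>At neuron \<open>j\<close> this pattern selects piece \<open>p l j\<close>; with
    \<open>b\<close> as \<open>lo l\<close> and \<open>hi l\<close> the sums become the bounds of
    that piece.\<close>
  have "pattern_sum_ereal (d l) (k l) (pattern_of L d k p l) b $ j = b (p l j)" if j: "j < d l" for b j
    using activation_pattern_carrier[OF pattern l] j p[OF j] l
    by (intro pattern_sum_ereal_index) (auto simp: pattern_of_def)
  then show ?thesis
    using p unfolding fits_def by auto
qed

theorem theorem1:
  fixes L N :: nat
    and d k :: "nat \<Rightarrow> nat"
    and W :: "nat \<Rightarrow> real mat"
    and \<sigma> :: "nat \<Rightarrow> real \<Rightarrow> real"
    and \<alpha> \<gamma> :: "nat \<Rightarrow> nat \<Rightarrow> real"
    and lo hi :: "nat \<Rightarrow> nat \<Rightarrow> ereal"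
    and nrm :: "real vec \<Rightarrow> real"
    and cbar :: "real vec"
    and R :: real
  assumes "1 \<le> L"
    and "d 0 = N"
    and "\<And>l. l \<in> {1..L} \<Longrightarrow> W l \<in> carrier_mat (d l) (d (l - 1))"
    and "\<And>l. l \<in> {1..L} \<Longrightarrow> piecewise_affine_activation (\<sigma> l) (k l) (\<alpha> l) (\<gamma> l) (lo l) (hi l)"
    and "is_norm (d L) nrm"
    and "cbar \<in> carrier_vec (d L)"
    and "R > 0"
  shows "U_set L d \<sigma> nrm W cbar R =
    (\<Union>u\<in>activation_patterns L d k. P_set L d k \<alpha> \<gamma> lo hi nrm W u cbar R)"
proof (intro equalityI subsetI)
  fix c assume c: "c \<in> U_set L d \<sigma> nrm W cbar R"
  let ?x = "\<lambda>l. W l *\<^sub>v network W \<sigma> (l - 1) c"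
  let ?good = "\<lambda>l j p. p \<in> {1..k l} \<and> lo l p \<le> ereal (?x l $ j) \<and> ereal (?x l $ j) < hi l p"
  \<comment> \<open>The outer bounds are infinite, so every real lies in a piece. Beyond the width
    of the layer \<open>?x l $ j\<close> is still some real, so \<open>j\<close> ranges over all
    naturals and the choice of \<open>p\<close> is guarded by \<open>l\<close> alone.\<close>
  have "\<exists>p. ?good l j p" if "l \<in> {1..L}" for l j
    using exists_half_open_piece[of "k l" "hi l" "lo l" "ereal (?x l $ j)"] assms(4)[OF that]
    by (auto simp: piecewise_affine_activation_def)
  then obtain p where p: "\<And>l j. l \<in> {1..L} \<Longrightarrow> ?good l j (p l j)"
    by metis
  let ?u = "pattern_of L d k p"
  have u: "?u \<in> activation_patterns L d k"
    using p by (intro pattern_of_in_activation_patterns) blast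
  interpret patterned_network L d k W \<sigma> \<alpha> \<gamma> lo hi ?u
    using assms(1,3,4) u by unfold_locales
  have "fits l (?x l)" if "l \<in> {1..L}" for l
    using p[OF that] by (intro fits_pattern_of[OF patterned_network_axioms that])
  then show "c \<in> (\<Union>u\<in>activation_patterns L d k. P_set L d k \<alpha> \<gamma> lo hi nrm W u cbar R)"
    using U_set_fits_imp_P_set[OF c] u by blast
next
  fix c assume "c \<in> (\<Union>u\<in>activation_patterns L d k. P_set L d k \<alpha> \<gamma> lo hi nrm W u cbar R)"
  then obtain u where u: "u \<in> activation_patterns L d k"
    and c: "c \<in> P_set L d k \<alpha> \<gamma> lo hi nrm W u cbar R"
    by blast
  interpret patterned_network L d k W \<sigma> \<alpha> \<gamma> lo hi u
    using assms(1,3,4) u by unfold_locales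
  show "c \<in> U_set L d \<sigma> nrm W cbar R"
    using c P_set_subset_U_set by blast
qed

end
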